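(* Let $A$ be a semisimple complex Banach algebra with identity and $\mathrm{Soc}\,A\neq\{0\}$, and let $\mathcal{C}=\{xy-yx: x,y\in\mathrm{Soc}\,A\}$. Then $\mathcal{C}=\{0\}$ if and only if $\mathrm{Soc}\,A\subseteq Z(A)$.
   Context: $Z(A)=\{x\in A: xy=yx\text{ for all }y\in A\}$ is the center of $A$. $\mathrm{Soc}\,A$ is the socle of $A$, the sum of all minimal left ideals of $A$ ($\{0\}$ if there are none). For semisimple $A$ it is a two-sided ideal and coincides with the set of finite-rank elements, i.e. those $a\in A$ with $\mathrm{rank}(a)=\sup_{x\in A}\#(\sigma(xa)\setminus\{0\})<\infty$, $\sigma$ denoting the spectrum. *)

theory Defs
  imports "HOL-Analysis.Analysis"
begin

(* HOL-Analysis only has real normed algebras, so the complex scalar action is added here,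
   compatible with the real one.  The norm is submultiplicative; norm 1 = 1 is not required. *)
class complex_banach_algebra = real_normed_algebra + real_algebra_1 + banach +
  fixes scaleC :: "complex \<Rightarrow> 'a \<Rightarrow> 'a" (infixr \<open>*\<^sub>C\<close> 75)
  assumes scaleC_add_right: "c *\<^sub>C (x + y) = c *\<^sub>C x + c *\<^sub>C y"
    and scaleC_add_left: "(c + d) *\<^sub>C x = c *\<^sub>C x + d *\<^sub>C x"
    and scaleC_scaleC: "c *\<^sub>C d *\<^sub>C x = (c * d) *\<^sub>C x"
    and scaleC_one: "1 *\<^sub>C x = x"
    and scaleC_of_real: "complex_of_real r *\<^sub>C x = r *\<^sub>R x"
    and mult_scaleC_left: "(c *\<^sub>C x) * y = c *\<^sub>C (x * y)"
    and mult_scaleC_right: "x * (c *\<^sub>C y) = c *\<^sub>C (x * y)"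
    and norm_scaleC: "norm (c *\<^sub>C x) = cmod c * norm x"

definition left_ideal :: "'a::complex_banach_algebra set \<Rightarrow> bool" where
  "left_ideal L \<longleftrightarrow> module.subspace scaleC L \<and> (\<forall>a. \<forall>x\<in>L. a * x \<in> L)"

definition maximal_left_ideal :: "'a::complex_banach_algebra set \<Rightarrow> bool" where
  "maximal_left_ideal M \<longleftrightarrow>
     left_ideal M \<and> M \<noteq> UNIV \<and> (\<forall>L. left_ideal L \<and> M \<subseteq> L \<longrightarrow> L = M \<or> L = UNIV)"

definition minimal_left_ideal :: "'a::complex_banach_algebra set \<Rightarrow> bool" where
  "minimal_left_ideal M \<longleftrightarrow>
     left_ideal M \<and> M \<noteq> {0} \<and> (\<forall>L. left_ideal L \<and> L \<subseteq> M \<longrightarrow> L = {0} \<or> L = M)"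

definition jacobson_radical :: "'a::complex_banach_algebra set" where
  "jacobson_radical = \<Inter>{M. maximal_left_ideal M}"

(* Semisimplicity in the sense of Banach algebra theory (Jacobson semisimple),
   not the Artinian notion. *)
definition semisimple_algebra :: "'a::complex_banach_algebra itself \<Rightarrow> bool" where
  "semisimple_algebra TYPE('a) \<longleftrightarrow> (jacobson_radical :: 'a set) = {0}"

(* All finite sums of elements of minimal left ideals; the empty sum gives 0. *)
definition socle :: "'a::complex_banach_algebra set" where
  "socle = {sum_list xs |xs. \<forall>x\<in>set xs. \<exists>L. minimal_left_ideal L \<and> x \<in> L}"

definition center :: "'a::complex_banach_algebra set" where
  "center = {x. \<forall>y. x * y = y * x}"

end

theory Submission
  imports Defs
begin

text \<open>If the socle \<open>I\<close> is commutative, then \<open>(x * a) * z = z * (x * a) = (x * z) * a\<close> for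
  \<open>x, z \<in> I\<close>, because \<open>I\<close> is a right ideal; so \<open>I\<close> annihilates every commutator
  \<open>w = a * z - z * a\<close> from the left.  As \<open>w \<in> I\<close>, every \<open>b * w\<close> squares to zero, hence
  \<open>1 - b * w\<close> is left invertible for all \<open>b\<close>, and \<open>w\<close> lies in the Jacobson radical.\<close>

section \<open>Left ideals and their images under right multiplication\<close>

lemma module_scaleC: "module (scaleC :: complex \<Rightarrow> 'a::complex_banach_algebra \<Rightarrow> 'a)"
  by unfold_locales
    (simp_all add: scaleC_add_right scaleC_add_left scaleC_scaleC scaleC_one)

text \<open>Since the algebra is unital, scaling by \<open>c\<close> is left multiplication by
  \<open>c *\<^sub>C 1\<close>, so closure under complex scalars follows from closure under left
  multiplication. Later ideal proofs thus check only ring conditions.\<close>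

lemma left_ideal_iff:
  "left_ideal (L :: 'a::complex_banach_algebra set) \<longleftrightarrow>
     0 \<in> L \<and> (\<forall>x\<in>L. \<forall>y\<in>L. x + y \<in> L) \<and> (\<forall>a. \<forall>x\<in>L. a * x \<in> L)"
proof -
  have "c *\<^sub>C x \<in> L" if "\<forall>a. \<forall>x\<in>L. a * x \<in> L" "x \<in> L" for c x
  proof -
    have "(c *\<^sub>C 1) * x \<in> L"
      using that by blast
    then show ?thesis
      by (simp add: mult_scaleC_left)
  qed
  then show ?thesis
    unfolding left_ideal_def module.subspace_def[OF module_scaleC] by blast
qed

lemma left_ideal_image_mult_right:
  assumes "left_ideal (L :: 'a::complex_banach_algebra set)"
  shows "left_ideal ((\<lambda>x. x * a) ` L)"
proof -
  have "0 \<in> (\<lambda>x. x * a) ` L"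
    using assms unfolding left_ideal_iff by (metis imageI mult_zero_left)
  moreover have "x * a + y * a \<in> (\<lambda>x. x * a) ` L" if "x \<in> L" "y \<in> L" for x y
    using assms that unfolding left_ideal_iff by (metis imageI distrib_right)
  moreover have "b * (x * a) \<in> (\<lambda>x. x * a) ` L" if "x \<in> L" for b x
    using assms that unfolding left_ideal_iff by (metis imageI mult.assoc)
  ultimately show ?thesis
    unfolding left_ideal_iff by auto
qed

text \<open>Right multiplication by \<open>a\<close> is a homomorphism of left modules, and a
  nonzero homomorphic image of a simple module is simple.\<close>

lemma minimal_left_ideal_image_mult_right:
  assumes "minimal_left_ideal (L :: 'a::complex_banach_algebra set)"
    and "(\<lambda>x. x * a) ` L \<noteq> {0}"
  shows "minimal_left_ideal ((\<lambda>x. x * a) ` L)"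
  unfolding minimal_left_ideal_def
proof (intro conjI allI impI)
  have L: "left_ideal L"
    using assms(1) by (simp add: minimal_left_ideal_def)
  then show "left_ideal ((\<lambda>x. x * a) ` L)"
    by (rule left_ideal_image_mult_right)
  show "(\<lambda>x. x * a) ` L \<noteq> {0}"
    by fact
  fix N assume N: "left_ideal N \<and> N \<subseteq> (\<lambda>x. x * a) ` L"
  \<comment> \<open>The preimage of \<open>N\<close> in \<open>L\<close>: minimality of
    \<open>L\<close> leaves only two choices for it, and \<open>N\<close> is recovered as its image
    because \<open>N\<close> lies in the image of \<open>L\<close>.\<close>
  define P where "P = {x \<in> L. x * a \<in> N}"
  have "left_ideal P"
    using L N unfolding left_ideal_iff P_def by (auto simp: distrib_right mult.assoc)
  moreover have "P \<subseteq> L"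
    by (auto simp: P_def)
  ultimately have "P = {0} \<or> P = L"
    using assms(1) by (simp add: minimal_left_ideal_def)
  moreover have "N = (\<lambda>x. x * a) ` P"
    using N by (auto simp: P_def)
  ultimately show "N = {0} \<or> N = (\<lambda>x. x * a) ` L"
    by auto
qed

section \<open>The socle as a two-sided ideal\<close>

lemma zero_in_socle: "0 \<in> (socle :: 'a::complex_banach_algebra set)"
  unfolding socle_def by (force intro: exI[of _ "[]"])

lemma minimal_left_ideal_subset_socle:
  assumes "minimal_left_ideal (L :: 'a::complex_banach_algebra set)"
  shows "L \<subseteq> socle"
proof
  fix x assume "x \<in> L"
  then have "x = sum_list [x]" "\<forall>y\<in>set [x]. \<exists>L. minimal_left_ideal L \<and> y \<in> L"
    using assms by auto
  then show "x \<in> socle"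
    unfolding socle_def by blast
qed

lemma socle_add:
  assumes "x \<in> (socle :: 'a::complex_banach_algebra set)" "y \<in> socle"
  shows "x + y \<in> socle"
proof -
  obtain xs ys where
    "x = sum_list xs" "\<forall>x\<in>set xs. \<exists>L. minimal_left_ideal L \<and> x \<in> L"
    "y = sum_list ys" "\<forall>x\<in>set ys. \<exists>L. minimal_left_ideal L \<and> x \<in> L"
    using assms unfolding socle_def by blast
  then have "x + y = sum_list (xs @ ys)"
    "\<forall>x\<in>set (xs @ ys). \<exists>L. minimal_left_ideal L \<and> x \<in> L"
    by auto
  then show ?thesis
    unfolding socle_def by blast
qed

text \<open>Peeling off one summand at a time reduces additive closure properties to elements of a
  single minimal left ideal.\<close>

lemma socle_induct [consumes 1, case_names zero add]:
  assumes "x \<in> (socle :: 'a::complex_banach_algebra set)"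
    and "P 0"
    and "\<And>L x y. minimal_left_ideal L \<Longrightarrow> x \<in> L \<Longrightarrow> P y \<Longrightarrow> P (x + y)"
  shows "P x"
proof -
  obtain xs where xs: "x = sum_list xs" "\<forall>x\<in>set xs. \<exists>L. minimal_left_ideal L \<and> x \<in> L"
    using assms(1) unfolding socle_def by blast
  from xs(2) have "P (sum_list xs)"
    by (induction xs) (auto intro: assms(2,3))
  then show ?thesis
    using xs(1) by simp
qed

lemma socle_mult_left:
  assumes "x \<in> (socle :: 'a::complex_banach_algebra set)"
  shows "a * x \<in> socle"
  using assms
proof (induction rule: socle_induct)
  case zero
  then show ?case by (simp add: zero_in_socle)
next
  case (add L x y)
  then have "a * x \<in> L"
    by (simp add: minimal_left_ideal_def left_ideal_iff)
  then have "a * x \<in> socle"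
    using add minimal_left_ideal_subset_socle by blast
  then show ?case
    using add by (simp add: distrib_left socle_add)
qed

text \<open>Right multiplication may move a summand out of its minimal left ideal \<open>L\<close>,
  but it lands in the image of \<open>L\<close>, which is zero or again a minimal left
  ideal.\<close>

lemma socle_mult_right:
  assumes "x \<in> (socle :: 'a::complex_banach_algebra set)"
  shows "x * a \<in> socle"
  using assms
proof (induction rule: socle_induct)
  case zero
  then show ?case by (simp add: zero_in_socle)
next
  case (add L x y)
  have "x * a \<in> socle"
  proof (cases "(\<lambda>x. x * a) ` L = {0}")
    case True
    then have "x * a = 0"
      using add by blast
    then show ?thesis
      by (simp add: zero_in_socle)
  next
    case False
    then show ?thesis
      using add minimal_left_ideal_image_mult_right minimal_left_ideal_subset_socle by blast
  qed
  then show ?case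
    using add by (simp add: distrib_right socle_add)
qed

lemma socle_commutator:
  assumes "z \<in> (socle :: 'a::complex_banach_algebra set)"
  shows "a * z - z * a \<in> socle"
  \<comment> \<open>The factor \<open>- a\<close> turns closure under sums into closure under this
    difference.\<close>
  using socle_add[OF socle_mult_left[OF assms, of a] socle_mult_right[OF assms, of "- a"]]
  by simp

section \<open>A criterion for membership in the Jacobson radical\<close>

lemma left_ideal_add_principal:
  assumes "left_ideal (M :: 'a::complex_banach_algebra set)"
  shows "left_ideal {m + b * w |m b. m \<in> M}"
proof -
  let ?N = "{m + b * w |m b. m \<in> M}"
  have "0 + 0 * w \<in> ?N"
    using assms unfolding left_ideal_iff by blast
  moreover have "(m + b * w) + (n + c * w) \<in> ?N" if "m \<in> M" "n \<in> M" for m n b c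
  proof -
    have "(m + b * w) + (n + c * w) = (m + n) + (b + c) * w"
      by (simp add: algebra_simps)
    then show ?thesis
      using assms that unfolding left_ideal_iff by blast
  qed
  moreover have "a * (m + b * w) \<in> ?N" if "m \<in> M" for a m b
  proof -
    have "a * (m + b * w) = a * m + (a * b) * w"
      by (simp add: algebra_simps)
    then show ?thesis
      using assms that unfolding left_ideal_iff by blast
  qed
  ultimately show ?thesis
    unfolding left_ideal_iff by auto
qed

text \<open>If a maximal left ideal \<open>M\<close> misses \<open>w\<close>, the left ideal
  generated by \<open>M\<close> and \<open>w\<close> is the whole algebra, so
  \<open>1 = m + b * w\<close> with \<open>m\<close> in \<open>M\<close>. Then
  \<open>m = 1 - b * w\<close> has a left inverse, which forces \<open>1\<close> into
  \<open>M\<close>.\<close>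

lemma in_jacobson_radicalI:
  fixes w :: "'a::complex_banach_algebra"
  assumes left_inv: "\<And>b. \<exists>u. u * (1 - b * w) = 1"
  shows "w \<in> jacobson_radical"
  unfolding jacobson_radical_def
proof (intro InterI, clarify, rule ccontr)
  fix M :: "'a set" assume M: "maximal_left_ideal M" and "w \<notin> M"
  have id: "left_ideal M" and proper: "M \<noteq> UNIV"
    using M by (auto simp: maximal_left_ideal_def)
  let ?N = "{m + b * w |m b. m \<in> M}"
  have "m + 0 * w \<in> ?N" if "m \<in> M" for m
    using that by blast
  then have "M \<subseteq> ?N"
    by auto
  moreover have "w \<in> ?N"
  proof -
    have "0 + 1 * w \<in> ?N"
      using id unfolding left_ideal_iff by blast
    then show ?thesis
      by (simp only: add_0 mult_1)
  qed
  ultimately have "?N = UNIV"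
    using M \<open>w \<notin> M\<close> left_ideal_add_principal[OF id, of w]
    unfolding maximal_left_ideal_def by blast
  then obtain m b where "1 = m + b * w" "m \<in> M"
    by blast
  then have "1 - b * w \<in> M"
    by (metis add_diff_cancel_right')
  then have "1 \<in> M"
    using left_inv[of b] id unfolding left_ideal_iff by metis
  then have "x * 1 \<in> M" for x
    using id unfolding left_ideal_iff by blast
  then show False
    using proper by auto
qed

section \<open>Centrality of a commutative socle\<close>

lemma socle_subset_center_if_commutative:
  assumes semisimple: "semisimple_algebra TYPE('a::complex_banach_algebra)"
    and comm: "\<And>x y :: 'a. x \<in> socle \<Longrightarrow> y \<in> socle \<Longrightarrow> x * y = y * x"
  shows "(socle :: 'a set) \<subseteq> center"
proof
  fix z :: 'a assume z: "z \<in> socle"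
  have "a * z - z * a = 0" for a
  proof -
    define w where "w = a * z - z * a"
    have w: "w \<in> socle"
      unfolding w_def using z by (rule socle_commutator)
    have ann: "x * w = 0" if x: "x \<in> socle" for x
    proof -
      have "x * a * z = z * x * a"
        using comm[OF socle_mult_right[OF x, of a] z] by (simp add: mult.assoc)
      also have "\<dots> = x * z * a"
        using comm[OF x z] by simp
      finally show ?thesis
        by (simp add: w_def right_diff_distrib mult.assoc)
    qed
    \<comment> \<open>The product is \<open>1 - (b * w * b) * w\<close>; the bracket lies in the
      two-sided ideal \<open>socle\<close>, so \<open>ann\<close> kills the last term.\<close>
    have "(1 + b * w) * (1 - b * w) = 1" for b
      using ann[OF socle_mult_right[OF socle_mult_left[OF w, of b], of b]]
      by (simp add: algebra_simps)
    then have "w \<in> jacobson_radical"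
      by (intro in_jacobson_radicalI) blast
    then show ?thesis
      using semisimple unfolding semisimple_algebra_def w_def by blast
  qed
  then show "z \<in> center"
    by (simp add: center_def)
qed

theorem theorem5p7:
  fixes C :: "'a::complex_banach_algebra set"
  assumes "semisimple_algebra TYPE('a)"
    and "(socle :: 'a set) \<noteq> {0}"
    and "C = {x * y - y * x |x y. x \<in> socle \<and> y \<in> socle}"
  shows "C = {0} \<longleftrightarrow> (socle :: 'a set) \<subseteq> center"
proof
  assume "C = {0}"
  then have "x * y - y * x = 0" if "x \<in> socle" "y \<in> socle" for x y :: 'a
    using assms(3) that by blast
  then show "(socle :: 'a set) \<subseteq> center"
    by (intro socle_subset_center_if_commutative assms(1)) simp
next
  assume "(socle :: 'a set) \<subseteq> center"
  then have "x * y - y * x = 0" if "x \<in> socle" for x y :: 'a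
    using that by (auto simp: center_def)
  then have "C \<subseteq> {0}"
    using assms(3) by blast
  \<comment> \<open>The inclusion alone would allow \<open>C\<close> to be empty; the zero
    commutator rules this out.\<close>
  moreover have "0 * 0 - 0 * 0 \<in> C"
    using assms(3) zero_in_socle by blast
  ultimately show "C = {0}"
    by auto
qed

end
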